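(* Let $M$ be a smooth surface in $\mathbb{E}^4$ given by a regular patch $X(u,v)$, $(u,v)\in D\subset\mathbb{E}^2$. Let $N_1,N_2$ be an orthonormal normal frame field of $M$, with associated coefficients $h_{ij}^\alpha$ of the second fundamental form and first and second harmonic curvatures $H_1,H_2$. Then $M$ is a non-trivial Chen surface if and only if $$\Bigl((h_{11}^1)^2-(h_{11}^2)^2+(h_{22}^1)^2-(h_{22}^2)^2+2(h_{12}^1)^2-2(h_{12}^2)^2\Bigr)H_1H_2+\Bigl(h_{11}^1h_{11}^2+h_{22}^1h_{22}^2+2h_{12}^1h_{12}^2\Bigr)(H_2^2-H_1^2)=0$$ holds.
   Context: Let $E=\langle X_u,X_u\rangle$, $F=\langle X_u,X_v\rangle$, $G=\langle X_v,X_v\rangle$, $W=\sqrt{EG-F^2}$ (nonzero, since the patch is regular), and let $h$ be the second fundamental form of $M$ (with values in the normal bundle). Use the orthonormal tangent frame field $\mathsf{X}=\frac{X_u}{\sqrt E}$, $\mathsf{Y}=\frac{\sqrt E}{W}\bigl(X_v-\frac{F}{E}X_u\bigr)$. For an orthonormal normal frame $N_1,N_2$ put $h_{11}^\alpha=\langle h(\mathsf X,\mathsf X),N_\alpha\rangle$, $h_{12}^\alpha=\langle h(\mathsf X,\mathsf Y),N_\alpha\rangle$, $h_{22}^\alpha=\langle h(\mathsf Y,\mathsf Y),N_\alpha\rangle$, $\alpha=1,2$. The first and second harmonic curvatures are $H_1=\frac12(h_{11}^1+h_{22}^1)$ and $H_2=\frac12(h_{11}^2+h_{22}^2)$, and the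 mean curvature vector is $\overrightarrow H=H_1N_1+H_2N_2$. For a normal field $N$, $A_N$ denotes the shape operator, $\langle A_N Z,Z'\rangle=\langle h(Z,Z'),N\rangle$ for tangent $Z,Z'$. If $\widetilde N_1,\widetilde N_2$ is an orthonormal normal frame with $\widetilde N_1$ parallel to $\overrightarrow H$, the allied mean curvature vector field is $a(\overrightarrow H)=\frac{\|\overrightarrow H\|}{2}\,\mathrm{tr}(A_{\widetilde N_1}A_{\widetilde N_2})\,\widetilde N_2$. $M$ is called a Chen surface (or $\mathcal A$-surface) if $a(\overrightarrow H)$ vanishes identically. The class of Chen surfaces contains all minimal surfaces ($\overrightarrow H\equiv0$), all pseudo-umbilical surfaces ($A_{\overrightarrow H}$ proportional to the identity), and all surfaces whose first normal space (the span of the values of $h$) has dimension at most $1$; these are called trivial Chen surfaces (trivial $\mathcal A$-surfaces), and a Chen surface that is not of these types is called non-trivial.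
   Formalization: As stated, "if" fails for trivial Chen surfaces (a plane satisfies the equation); what is proved is: M is a Chen surface iff the equation holds, and, when M is not of a trivial type, M is a non-trivial Chen surface iff the equation holds. *)

theory Defs
  imports "HOL-Analysis.Analysis"
begin

primrec Ck_on :: "nat \<Rightarrow> 'a::real_normed_vector set \<Rightarrow> ('a \<Rightarrow> 'b::real_normed_vector) \<Rightarrow> bool" where
  "Ck_on 0 S f \<longleftrightarrow> continuous_on S f"
| "Ck_on (Suc k) S f \<longleftrightarrow> (\<forall>x\<in>S. f differentiable (at x)) \<and>
     (\<forall>v. Ck_on k S (\<lambda>x. frechet_derivative f (at x) v))"

(* Meant for open S and a finite-dimensional domain: only directional derivatives are required
   to be of class C^k, which there is the usual notion. *)
definition smooth_on :: "'a::real_normed_vector set \<Rightarrow> ('a \<Rightarrow> 'b::real_normed_vector) \<Rightarrow> bool" where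
  "smooth_on S f \<longleftrightarrow> (\<forall>k. Ck_on k S f)"

definition regular_patch :: "(real \<times> real) set \<Rightarrow> (real \<times> real \<Rightarrow> real ^ 4) \<Rightarrow> bool" where
  "regular_patch D X \<longleftrightarrow> open D \<and> smooth_on D X \<and>
     (\<forall>p\<in>D. inj (frechet_derivative X (at p)))"

definition X_u :: "(real \<times> real \<Rightarrow> real ^ 4) \<Rightarrow> real \<times> real \<Rightarrow> real ^ 4" where
  "X_u X p = frechet_derivative X (at p) (1, 0)"

definition X_v :: "(real \<times> real \<Rightarrow> real ^ 4) \<Rightarrow> real \<times> real \<Rightarrow> real ^ 4" where
  "X_v X p = frechet_derivative X (at p) (0, 1)"

definition fff_E :: "(real \<times> real \<Rightarrow> real ^ 4) \<Rightarrow> real \<times> real \<Rightarrow> real" where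
  "fff_E X p = X_u X p \<bullet> X_u X p"

definition fff_F :: "(real \<times> real \<Rightarrow> real ^ 4) \<Rightarrow> real \<times> real \<Rightarrow> real" where
  "fff_F X p = X_u X p \<bullet> X_v X p"

definition fff_G :: "(real \<times> real \<Rightarrow> real ^ 4) \<Rightarrow> real \<times> real \<Rightarrow> real" where
  "fff_G X p = X_v X p \<bullet> X_v X p"

definition fff_W :: "(real \<times> real \<Rightarrow> real ^ 4) \<Rightarrow> real \<times> real \<Rightarrow> real" where
  "fff_W X p = sqrt (fff_E X p * fff_G X p - (fff_F X p)\<^sup>2)"

definition frame_X :: "(real \<times> real \<Rightarrow> real ^ 4) \<Rightarrow> real \<times> real \<Rightarrow> real ^ 4" where
  "frame_X X p = X_u X p /\<^sub>R sqrt (fff_E X p)"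

definition frame_Y :: "(real \<times> real \<Rightarrow> real ^ 4) \<Rightarrow> real \<times> real \<Rightarrow> real ^ 4" where
  "frame_Y X p = (sqrt (fff_E X p) / fff_W X p) *\<^sub>R
     (X_v X p - (fff_F X p / fff_E X p) *\<^sub>R X_u X p)"

definition tangent_space :: "(real \<times> real \<Rightarrow> real ^ 4) \<Rightarrow> real \<times> real \<Rightarrow> (real ^ 4) set" where
  "tangent_space X p = span {X_u X p, X_v X p}"

definition normal_space :: "(real \<times> real \<Rightarrow> real ^ 4) \<Rightarrow> real \<times> real \<Rightarrow> (real ^ 4) set" where
  "normal_space X p = orthogonal_comp (tangent_space X p)"

definition normal_part :: "(real \<times> real \<Rightarrow> real ^ 4) \<Rightarrow> real \<times> real \<Rightarrow> real ^ 4 \<Rightarrow> real ^ 4" where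
  "normal_part X p w = (THE n. n \<in> normal_space X p \<and> w - n \<in> tangent_space X p)"

(* Gauss formula: h(Z, Z') is the normal part of the ambient derivative, in the direction Z,
   of a tangent field extending Z'.  The extension used is q \<mapsto> dX_q(\<zeta>') with the constant
   coordinate vector \<zeta>' of Z'; so, at p, h(X_u, X_v) is the normal part of X_uv, etc.
   Z and Z' are meant to lie in the tangent space at p, where inv dX_p gives their coordinates. *)
definition sff :: "(real \<times> real \<Rightarrow> real ^ 4) \<Rightarrow> real \<times> real \<Rightarrow> real ^ 4 \<Rightarrow> real ^ 4 \<Rightarrow> real ^ 4" where
  "sff X p Z Z' =
     (let \<zeta> = inv (frechet_derivative X (at p)) Z;
          \<zeta>' = inv (frechet_derivative X (at p)) Z'
      in normal_part X p
           (frechet_derivative (\<lambda>q. frechet_derivative X (at q) \<zeta>') (at p) \<zeta>))"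

definition orthonormal_normal_pair ::
    "(real \<times> real \<Rightarrow> real ^ 4) \<Rightarrow> real \<times> real \<Rightarrow> real ^ 4 \<Rightarrow> real ^ 4 \<Rightarrow> bool" where
  "orthonormal_normal_pair X p n1 n2 \<longleftrightarrow>
     n1 \<in> normal_space X p \<and> n2 \<in> normal_space X p \<and> norm n1 = 1 \<and> norm n2 = 1 \<and> n1 \<bullet> n2 = 0"

definition orthonormal_normal_frame ::
    "(real \<times> real) set \<Rightarrow> (real \<times> real \<Rightarrow> real ^ 4) \<Rightarrow>
     (real \<times> real \<Rightarrow> real ^ 4) \<Rightarrow> (real \<times> real \<Rightarrow> real ^ 4) \<Rightarrow> bool" where
  "orthonormal_normal_frame D X N1 N2 \<longleftrightarrow> smooth_on D N1 \<and> smooth_on D N2 \<and>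
     (\<forall>p\<in>D. orthonormal_normal_pair X p (N1 p) (N2 p))"

definition h11 :: "(real \<times> real \<Rightarrow> real ^ 4) \<Rightarrow> (real \<times> real \<Rightarrow> real ^ 4) \<Rightarrow> real \<times> real \<Rightarrow> real" where
  "h11 X N p = sff X p (frame_X X p) (frame_X X p) \<bullet> N p"

definition h12 :: "(real \<times> real \<Rightarrow> real ^ 4) \<Rightarrow> (real \<times> real \<Rightarrow> real ^ 4) \<Rightarrow> real \<times> real \<Rightarrow> real" where
  "h12 X N p = sff X p (frame_X X p) (frame_Y X p) \<bullet> N p"

definition h22 :: "(real \<times> real \<Rightarrow> real ^ 4) \<Rightarrow> (real \<times> real \<Rightarrow> real ^ 4) \<Rightarrow> real \<times> real \<Rightarrow> real" where
  "h22 X N p = sff X p (frame_Y X p) (frame_Y X p) \<bullet> N p"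

definition harmonic_curvature ::
    "(real \<times> real \<Rightarrow> real ^ 4) \<Rightarrow> (real \<times> real \<Rightarrow> real ^ 4) \<Rightarrow> real \<times> real \<Rightarrow> real" where
  "harmonic_curvature X N p = (h11 X N p + h22 X N p) / 2"

(* Frame-free form of H_1 N_1 + H_2 N_2; see mean_curvature_vector_eq below. *)
definition mean_curvature_vector :: "(real \<times> real \<Rightarrow> real ^ 4) \<Rightarrow> real \<times> real \<Rightarrow> real ^ 4" where
  "mean_curvature_vector X p =
     (1 / 2) *\<^sub>R (sff X p (frame_X X p) (frame_X X p) + sff X p (frame_Y X p) (frame_Y X p))"

definition shape_operator ::
    "(real \<times> real \<Rightarrow> real ^ 4) \<Rightarrow> real \<times> real \<Rightarrow> real ^ 4 \<Rightarrow> real ^ 4 \<Rightarrow> real ^ 4" where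
  "shape_operator X p n Z = (THE T. T \<in> tangent_space X p \<and>
     (\<forall>Z'\<in>tangent_space X p. T \<bullet> Z' = sff X p Z Z' \<bullet> n))"

definition tangent_trace ::
    "(real \<times> real \<Rightarrow> real ^ 4) \<Rightarrow> real \<times> real \<Rightarrow> (real ^ 4 \<Rightarrow> real ^ 4) \<Rightarrow> real" where
  "tangent_trace X p L = L (frame_X X p) \<bullet> frame_X X p + L (frame_Y X p) \<bullet> frame_Y X p"

definition allied_mean_curvature ::
    "(real \<times> real \<Rightarrow> real ^ 4) \<Rightarrow> real \<times> real \<Rightarrow> real ^ 4 \<Rightarrow> real ^ 4 \<Rightarrow> real ^ 4" where
  "allied_mean_curvature X p n1 n2 =
     (norm (mean_curvature_vector X p) / 2 *
      tangent_trace X p (shape_operator X p n1 \<circ> shape_operator X p n2)) *\<^sub>R n2"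

(* The adapted normal frame is taken point by point, since a smooth one need not exist across
   zeros of the mean curvature vector.  It is unique up to signs where that vector is nonzero;
   a sign change of n1 changes the sign of the allied vector, which does not affect its vanishing.
   Where the mean curvature vector is zero, every n1 is admissible and the allied vector is 0. *)
definition chen_surface :: "(real \<times> real) set \<Rightarrow> (real \<times> real \<Rightarrow> real ^ 4) \<Rightarrow> bool" where
  "chen_surface D X \<longleftrightarrow> (\<forall>p\<in>D. \<forall>n1 n2.
     orthonormal_normal_pair X p n1 n2 \<and> (\<exists>c. mean_curvature_vector X p = c *\<^sub>R n1) \<longrightarrow>
     allied_mean_curvature X p n1 n2 = 0)"

definition minimal_surface :: "(real \<times> real) set \<Rightarrow> (real \<times> real \<Rightarrow> real ^ 4) \<Rightarrow> bool" where
  "minimal_surface D X \<longleftrightarrow> (\<forall>p\<in>D. mean_curvature_vector X p = 0)"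

definition pseudo_umbilical :: "(real \<times> real) set \<Rightarrow> (real \<times> real \<Rightarrow> real ^ 4) \<Rightarrow> bool" where
  "pseudo_umbilical D X \<longleftrightarrow> (\<forall>p\<in>D. \<exists>c. \<forall>Z\<in>tangent_space X p.
     shape_operator X p (mean_curvature_vector X p) Z = c *\<^sub>R Z)"

definition first_normal_space :: "(real \<times> real \<Rightarrow> real ^ 4) \<Rightarrow> real \<times> real \<Rightarrow> (real ^ 4) set" where
  "first_normal_space X p =
     span {sff X p Z Z' | Z Z'. Z \<in> tangent_space X p \<and> Z' \<in> tangent_space X p}"

definition trivial_type :: "(real \<times> real) set \<Rightarrow> (real \<times> real \<Rightarrow> real ^ 4) \<Rightarrow> bool" where
  "trivial_type D X \<longleftrightarrow> minimal_surface D X \<or> pseudo_umbilical D X \<or>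
     (\<forall>p\<in>D. dim (first_normal_space X p) \<le> 1)"

definition nontrivial_chen_surface :: "(real \<times> real) set \<Rightarrow> (real \<times> real \<Rightarrow> real ^ 4) \<Rightarrow> bool" where
  "nontrivial_chen_surface D X \<longleftrightarrow> chen_surface D X \<and> \<not> trivial_type D X"

lemma frame_in_tangent_space:
  "frame_X X p \<in> tangent_space X p" "frame_Y X p \<in> tangent_space X p"
  unfolding frame_X_def frame_Y_def tangent_space_def
  by (auto intro!: span_scale span_diff intro: span_base)

lemma frame_orthonormal:
  assumes "inj (frechet_derivative X (at p))" "X differentiable (at p)"
  shows "norm (frame_X X p) = 1" "norm (frame_Y X p) = 1" "frame_X X p \<bullet> frame_Y X p = 0"
    "fff_E X p > 0" "fff_W X p > 0"
proof -
  let ?d = "frechet_derivative X (at p)"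
  have lin: "linear ?d"
    using assms(2) by (rule linear_frechet_derivative)
  have nz: "?d z \<noteq> 0" if "z \<noteq> 0" for z
    using assms(1) lin that by (metis linear_0 injD)
  have u0: "X_u X p \<noteq> 0"
    unfolding X_u_def by (rule nz) (simp add: zero_prod_def)
  then show E: "fff_E X p > 0"
    unfolding fff_E_def by simp
  define c where "c = fff_F X p / fff_E X p"
  define w where "w = X_v X p - c *\<^sub>R X_u X p"
  have "w = ?d ((0, 1) - c *\<^sub>R (1, 0))"
    unfolding w_def X_u_def X_v_def linear_diff[OF lin] linear_scale[OF lin] ..
  then have w0: "w \<noteq> 0"
    using nz[of "(0, 1) - c *\<^sub>R (1, 0)"] by (simp add: zero_prod_def)
  have "w \<bullet> w = fff_G X p - 2 * c * fff_F X p + c\<^sup>2 * fff_E X p"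
    unfolding w_def fff_E_def fff_F_def fff_G_def
    by (simp add: inner_diff inner_commute power2_eq_square algebra_simps)
  also have "\<dots> = (fff_E X p * fff_G X p - (fff_F X p)\<^sup>2) / fff_E X p"
    using E unfolding c_def by (simp add: field_simps power2_eq_square)
  finally have ww: "w \<bullet> w = (fff_E X p * fff_G X p - (fff_F X p)\<^sup>2) / fff_E X p" .
  have "w \<bullet> w > 0" using w0 by simp
  then have pos: "fff_E X p * fff_G X p - (fff_F X p)\<^sup>2 > 0"
    unfolding ww using E by (simp add: zero_less_divide_iff)
  then show W: "fff_W X p > 0"
    unfolding fff_W_def by simp
  have nu: "norm (X_u X p) = sqrt (fff_E X p)"
    unfolding fff_E_def norm_eq_sqrt_inner ..
  have nw: "norm w = fff_W X p / sqrt (fff_E X p)"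
    unfolding norm_eq_sqrt_inner ww fff_W_def by (simp add: real_sqrt_divide)
  show "norm (frame_X X p) = 1"
    unfolding frame_X_def using E nu by simp
  have fY: "frame_Y X p = (sqrt (fff_E X p) / fff_W X p) *\<^sub>R w"
    unfolding frame_Y_def w_def c_def ..
  show "norm (frame_Y X p) = 1"
    unfolding fY using E W nw by simp
  have "X_u X p \<bullet> w = fff_F X p - c * fff_E X p"
    unfolding w_def fff_E_def fff_F_def by (simp add: inner_diff)
  also have "\<dots> = 0" using E unfolding c_def by simp
  finally show "frame_X X p \<bullet> frame_Y X p = 0"
    unfolding frame_X_def fY by simp
qed

lemma tangent_space_eq_span_frame:
  assumes "inj (frechet_derivative X (at p))" "X differentiable (at p)"
  shows "tangent_space X p = span {frame_X X p, frame_Y X p}"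
proof
  note E = frame_orthonormal(4)[OF assms] and W = frame_orthonormal(5)[OF assms]
  let ?S = "span {frame_X X p, frame_Y X p}"
  show "?S \<subseteq> tangent_space X p"
    using frame_in_tangent_space[of X p] unfolding tangent_space_def
    by (intro span_minimal) auto
  have u: "X_u X p = sqrt (fff_E X p) *\<^sub>R frame_X X p"
    unfolding frame_X_def using E by simp
  have v: "X_v X p = (fff_W X p / sqrt (fff_E X p)) *\<^sub>R frame_Y X p +
      (fff_F X p / fff_E X p) *\<^sub>R X_u X p"
    unfolding frame_Y_def using E W by simp
  have 1: "X_u X p \<in> ?S"
    unfolding u by (intro span_scale span_base) auto
  have 2: "X_v X p \<in> ?S"
    by (subst v) (intro span_add span_scale 1, auto intro: span_base)
  show "tangent_space X p \<subseteq> ?S"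
    unfolding tangent_space_def using 1 2 by (intro span_minimal) auto
qed

lemma normal_part_unique:
  assumes "n \<in> normal_space X p" "w - n \<in> tangent_space X p"
  shows "normal_part X p w = n"
  unfolding normal_part_def
proof (rule the_equality)
  show "n \<in> normal_space X p \<and> w - n \<in> tangent_space X p" using assms by blast
next
  fix m assume m: "m \<in> normal_space X p \<and> w - m \<in> tangent_space X p"
  have "(w - n) - (w - m) \<in> tangent_space X p"
    using assms m unfolding tangent_space_def by (blast intro: span_diff)
  then have t: "m - n \<in> tangent_space X p" by simp
  then have "(m - n) \<bullet> m = 0" "(m - n) \<bullet> n = 0"
    using m assms unfolding normal_space_def orthogonal_comp_def orthogonal_def by auto
  then have "(m - n) \<bullet> (m - n) = 0" by (simp add: inner_diff)
  then show "m = n" by simp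
qed

lemma normal_part_in_normal_space:
  "normal_part X p w \<in> normal_space X p" "w - normal_part X p w \<in> tangent_space X p"
proof -
  obtain y z where yz: "y \<in> span {X_u X p, X_v X p}"
      "\<And>t. t \<in> span {X_u X p, X_v X p} \<Longrightarrow> orthogonal z t" "w = y + z"
    using orthogonal_subspace_decomp_exists[of "{X_u X p, X_v X p}" w] by blast
  then have "z \<in> normal_space X p" "w - z \<in> tangent_space X p"
    unfolding normal_space_def orthogonal_comp_def tangent_space_def
    by (auto simp: orthogonal_commute)
  with normal_part_unique show "normal_part X p w \<in> normal_space X p"
    "w - normal_part X p w \<in> tangent_space X p" by metis+
qed

lemma normal_vector_expansion:
  assumes X: "inj (frechet_derivative X (at p))" "X differentiable (at p)"
    and N: "orthonormal_normal_pair X p n1 n2" and n: "n \<in> normal_space X p"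
  shows "n = (n \<bullet> n1) *\<^sub>R n1 + (n \<bullet> n2) *\<^sub>R n2"
proof -
  let ?x = "frame_X X p" and ?y = "frame_Y X p"
  let ?B = "{?x, ?y, n1, n2}"
  have orth: "?x \<bullet> m = 0" "?y \<bullet> m = 0" if "m \<in> normal_space X p" for m
    using that frame_in_tangent_space[of X p]
    unfolding normal_space_def orthogonal_comp_def orthogonal_def by auto
  have unit: "?x \<bullet> ?x = 1" "?y \<bullet> ?y = 1" "n1 \<bullet> n1 = 1" "n2 \<bullet> n2 = 1"
    using frame_orthonormal(1,2)[OF X] N unfolding orthonormal_normal_pair_def
    by (auto simp: norm_eq_1)
  have o: "?x \<bullet> ?y = 0" "?x \<bullet> n1 = 0" "?x \<bullet> n2 = 0" "?y \<bullet> n1 = 0" "?y \<bullet> n2 = 0" "n1 \<bullet> n2 = 0"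
    using frame_orthonormal(3)[OF X] N orth unfolding orthonormal_normal_pair_def by auto
  have ne: "?x \<noteq> ?y" "?x \<noteq> n1" "?x \<noteq> n2" "?y \<noteq> n1" "?y \<noteq> n2" "n1 \<noteq> n2"
    using o unit by force+
  have "pairwise orthogonal ?B"
    using o unfolding pairwise_def orthogonal_def by (auto simp: inner_commute)
  moreover have "0 \<notin> ?B" using unit by auto
  ultimately have "independent ?B" by (rule pairwise_orthogonal_independent)
  moreover have "card ?B = 4" using ne by simp
  ultimately have "span ?B = UNIV"
    using card_ge_dim_independent[of ?B UNIV] by (simp add: dim_UNIV top.extremum_unique)
  define r where "r = n - ((n \<bullet> n1) *\<^sub>R n1 + (n \<bullet> n2) *\<^sub>R n2)"
  have "orthogonal r b" if "b \<in> ?B" for b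
    using that o unit orth[OF n] unfolding r_def orthogonal_def
    by (auto simp: inner_diff inner_add inner_commute)
  then have "orthogonal r r"
    using orthogonal_to_span[of r ?B r] \<open>span ?B = UNIV\<close> by auto
  then have "r = 0" by (simp add: orthogonal_self)
  then show ?thesis unfolding r_def by simp
qed

lemma mean_curvature_vector_eq:
  assumes "inj (frechet_derivative X (at p))" "X differentiable (at p)"
    and "orthonormal_normal_pair X p (N1 p) (N2 p)"
  shows "mean_curvature_vector X p =
    harmonic_curvature X N1 p *\<^sub>R N1 p + harmonic_curvature X N2 p *\<^sub>R N2 p"
proof -
  have "sff X p Z Z' \<in> normal_space X p" for Z Z'
    unfolding sff_def Let_def by (rule normal_part_in_normal_space)
  then have "sff X p Z Z' =
      (sff X p Z Z' \<bullet> N1 p) *\<^sub>R N1 p + (sff X p Z Z' \<bullet> N2 p) *\<^sub>R N2 p" for Z Z'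
    by (rule normal_vector_expansion[OF assms])
  from this[of "frame_X X p" "frame_X X p"] this[of "frame_Y X p" "frame_Y X p"]
  have "mean_curvature_vector X p = (1 / 2) *\<^sub>R
      ((h11 X N1 p *\<^sub>R N1 p + h11 X N2 p *\<^sub>R N2 p) + (h22 X N1 p *\<^sub>R N1 p + h22 X N2 p *\<^sub>R N2 p))"
    unfolding mean_curvature_vector_def h11_def h22_def by simp
  then show ?thesis
    unfolding harmonic_curvature_def by (simp add: algebra_simps add_divide_distrib)
qed

end

theory Submission
  imports Defs
begin

text \<open>
  At a point where the mean curvature vector is nonzero, the adapted frame arises from
  \<open>N\<^sub>1, N\<^sub>2\<close> by the rotation (up to reflection) with
  \<open>cos \<theta> : sin \<theta> = H\<^sub>1 : H\<^sub>2\<close>. The trace of \<open>A\<^sub>n A\<^sub>m\<close> is the symmetric bilinear form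
  \<open>Q(n, m) = h\<^sub>1\<^sub>1(n) h\<^sub>1\<^sub>1(m) + 2 h\<^sub>1\<^sub>2(n) h\<^sub>1\<^sub>2(m) + h\<^sub>2\<^sub>2(n) h\<^sub>2\<^sub>2(m)\<close> on the normal space, because the second
  fundamental form is symmetric (Schwarz's theorem). The left side of the equation is
  \<open>(Q\<^sub>1\<^sub>1 - Q\<^sub>2\<^sub>2) H\<^sub>1 H\<^sub>2 + Q\<^sub>1\<^sub>2 (H\<^sub>2\<^sup>2 - H\<^sub>1\<^sup>2)\<close>, which equals \<open>Q\<close> on the adapted frame up to sign and
  the factor \<open>H\<^sub>1\<^sup>2 + H\<^sub>2\<^sup>2\<close>. Where the mean curvature vector vanishes, so do both the allied
  vector and the left side.
\<close>

section \<open>Symmetry of second derivatives\<close>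

text \<open>The mean value theorem is applied twice, once in each direction. The intermediate point
  stays in the parallelogram spanned by \<open>s *\<^sub>R v\<close> and
  \<open>s *\<^sub>R w\<close>, so derivatives are needed only there.\<close>

lemma second_difference_eq:
  fixes f :: "'a::real_normed_vector \<Rightarrow> real"
  assumes f': "\<And>q. q \<in> D \<Longrightarrow> (f has_derivative f' q) (at q)"
    and f'': "\<And>q. q \<in> D \<Longrightarrow> ((\<lambda>x. f' x v) has_derivative f'' q) (at q)"
    and D: "\<And>a b. 0 \<le> a \<Longrightarrow> a \<le> s \<Longrightarrow> 0 \<le> b \<Longrightarrow> b \<le> s \<Longrightarrow> p + a *\<^sub>R v + b *\<^sub>R w \<in> D"
    and s: "0 < s"
  obtains a b where "0 < a" "a < s" "0 < b" "b < s"
    "f (p + s *\<^sub>R v + s *\<^sub>R w) - f (p + s *\<^sub>R v) - f (p + s *\<^sub>R w) + f p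
       = s\<^sup>2 * f'' (p + a *\<^sub>R v + b *\<^sub>R w) w"
proof -
  have D0: "p + a *\<^sub>R v \<in> D" if "0 \<le> a" "a \<le> s" for a
    using D[of a 0] that s by simp
  have lin: "linear (f' q)" if "q \<in> D" for q
    using f'[OF that] by (rule has_derivative_linear)
  have lin': "linear (f'' q)" if "q \<in> D" for q
    using f''[OF that] by (rule has_derivative_linear)
  have der: "((\<lambda>x. f (p + x *\<^sub>R v + s *\<^sub>R w) - f (p + x *\<^sub>R v)) has_derivative
      (\<lambda>t. f' (p + a *\<^sub>R v + s *\<^sub>R w) (t *\<^sub>R v) - f' (p + a *\<^sub>R v) (t *\<^sub>R v))) (at a within {0..s})"
    if "0 \<le> a" "a \<le> s" for a
  proof (rule has_derivative_diff)
    have "((\<lambda>x. p + x *\<^sub>R v + s *\<^sub>R w) has_derivative (\<lambda>t. t *\<^sub>R v)) (at a within {0..s})"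
      by (auto intro!: derivative_eq_intros)
    then show "((\<lambda>x. f (p + x *\<^sub>R v + s *\<^sub>R w)) has_derivative
        (\<lambda>t. f' (p + a *\<^sub>R v + s *\<^sub>R w) (t *\<^sub>R v))) (at a within {0..s})"
      by (rule has_derivative_compose) (use f' D that s in simp)
    have "((\<lambda>x. p + x *\<^sub>R v) has_derivative (\<lambda>t. t *\<^sub>R v)) (at a within {0..s})"
      by (auto intro!: derivative_eq_intros)
    then show "((\<lambda>x. f (p + x *\<^sub>R v)) has_derivative (\<lambda>t. f' (p + a *\<^sub>R v) (t *\<^sub>R v)))
        (at a within {0..s})"
      by (rule has_derivative_compose) (use f' D0 that in simp)
  qed
  \<comment> \<open>First application: to the difference of \<open>f\<close> along the two sides
    parallel to \<open>v\<close>, as a function of the position on them.\<close>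
  obtain a where a: "0 < a" "a < s" and
    A: "(f (p + s *\<^sub>R v + s *\<^sub>R w) - f (p + s *\<^sub>R v)) - (f (p + 0 *\<^sub>R v + s *\<^sub>R w) - f (p + 0 *\<^sub>R v))
       = f' (p + a *\<^sub>R v + s *\<^sub>R w) ((s - 0) *\<^sub>R v) - f' (p + a *\<^sub>R v) ((s - 0) *\<^sub>R v)"
    using mvt_simple[OF s der] by auto
  have der2: "((\<lambda>y. f' (p + a *\<^sub>R v + y *\<^sub>R w) v) has_derivative
      (\<lambda>t. f'' (p + a *\<^sub>R v + b *\<^sub>R w) (t *\<^sub>R w))) (at b within {0..s})"
    if "0 \<le> b" "b \<le> s" for b
  proof -
    have "((\<lambda>y. p + a *\<^sub>R v + y *\<^sub>R w) has_derivative (\<lambda>t. t *\<^sub>R w)) (at b within {0..s})"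
      by (auto intro!: derivative_eq_intros)
    then show ?thesis
      by (rule has_derivative_compose) (use f'' D that a in simp)
  qed
  \<comment> \<open>Second application: to the derivative in direction \<open>v\<close>, moving
    along \<open>w\<close> with \<open>a\<close> fixed.\<close>
  obtain b where b: "0 < b" "b < s" and
    B: "f' (p + a *\<^sub>R v + s *\<^sub>R w) v - f' (p + a *\<^sub>R v + 0 *\<^sub>R w) v
       = f'' (p + a *\<^sub>R v + b *\<^sub>R w) ((s - 0) *\<^sub>R w)"
    using mvt_simple[OF s der2] by auto
  have in_D: "p + a *\<^sub>R v + s *\<^sub>R w \<in> D" "p + a *\<^sub>R v \<in> D" "p + a *\<^sub>R v + b *\<^sub>R w \<in> D"
    using D D0 a b by (simp_all add: less_imp_le)
  have "f (p + s *\<^sub>R v + s *\<^sub>R w) - f (p + s *\<^sub>R v) - f (p + s *\<^sub>R w) + f p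
       = s * (f' (p + a *\<^sub>R v + s *\<^sub>R w) v - f' (p + a *\<^sub>R v) v)"
    using A in_D[THEN lin] by (simp add: linear_scale algebra_simps)
  also have "\<dots> = s\<^sup>2 * f'' (p + a *\<^sub>R v + b *\<^sub>R w) w"
    using B in_D[THEN lin'] by (simp add: linear_scale power2_eq_square)
  finally show thesis using that a b by blast
qed

text \<open>The parallelogram containing the intermediate point shrinks to \<open>p\<close>, so
  continuity of \<open>f'' q w\<close> in \<open>q\<close> gives the limit.\<close>

lemma second_difference_tendsto:
  fixes f :: "'a::real_normed_vector \<Rightarrow> real"
  assumes D: "open D" "p \<in> D"
    and f': "\<And>q. q \<in> D \<Longrightarrow> (f has_derivative f' q) (at q)"
    and f'': "\<And>q. q \<in> D \<Longrightarrow> ((\<lambda>x. f' x v) has_derivative f'' q) (at q)"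
    and cont: "continuous_on D (\<lambda>q. f'' q w)"
  shows "((\<lambda>s. (f (p + s *\<^sub>R v + s *\<^sub>R w) - f (p + s *\<^sub>R v) - f (p + s *\<^sub>R w) + f p) / s\<^sup>2)
    \<longlongrightarrow> f'' p w) (at_right 0)"
proof (rule tendstoI)
  fix e :: real assume "0 < e"
  have "isCont (\<lambda>q. f'' q w) p"
    using cont D continuous_on_eq_continuous_at by blast
  then obtain d1 where d1: "d1 > 0" "\<And>q. dist q p < d1 \<Longrightarrow> dist (f'' q w) (f'' p w) < e"
    using \<open>0 < e\<close> unfolding continuous_at_eps_delta by blast
  obtain d2 where d2: "d2 > 0" "ball p d2 \<subseteq> D"
    using D open_contains_ball by blast
  \<comment> \<open>For side parameters below \<open>r\<close> the whole parallelogram lies within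
    \<open>min d1 d2\<close> of \<open>p\<close>; the summand 1 keeps the denominator positive when
    \<open>v\<close> and \<open>w\<close> are both zero.\<close>
  define r where "r = min d1 d2 / (norm v + norm w + 1)"
  have K: "norm v + norm w + 1 > 0"
    by (smt (verit) norm_ge_zero)
  have r: "r > 0" unfolding r_def using d1 d2 K by simp
  have near: "dist (p + a *\<^sub>R v + b *\<^sub>R w) p < min d1 d2"
    if "0 \<le> a" "a \<le> s" "0 \<le> b" "b \<le> s" "s < r" for a b s
  proof -
    have "dist (p + a *\<^sub>R v + b *\<^sub>R w) p = norm (a *\<^sub>R v + b *\<^sub>R w)"
      by (simp add: dist_norm algebra_simps)
    also have "\<dots> \<le> a * norm v + b * norm w"
      using norm_triangle_ineq[of "a *\<^sub>R v" "b *\<^sub>R w"] that by simp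
    also have "\<dots> \<le> s * norm v + s * norm w"
      using that by (intro add_mono mult_right_mono) auto
    also have "\<dots> \<le> s * (norm v + norm w + 1)"
      using that by (simp add: algebra_simps)
    also have "\<dots> < r * (norm v + norm w + 1)"
      using that K by (intro mult_strict_right_mono) auto
    also have "\<dots> = min d1 d2" unfolding r_def using K by simp
    finally show ?thesis .
  qed
  have "dist ((f (p + s *\<^sub>R v + s *\<^sub>R w) - f (p + s *\<^sub>R v) - f (p + s *\<^sub>R w) + f p) / s\<^sup>2) (f'' p w) < e"
    if s: "0 < s" "s < r" for s
  proof -
    have "p + a *\<^sub>R v + b *\<^sub>R w \<in> D" if "0 \<le> a" "a \<le> s" "0 \<le> b" "b \<le> s" for a b
      using near[OF that s(2)] d2(2) by (auto simp: dist_commute)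
    then obtain a b where ab: "0 < a" "a < s" "0 < b" "b < s"
      and eq: "f (p + s *\<^sub>R v + s *\<^sub>R w) - f (p + s *\<^sub>R v) - f (p + s *\<^sub>R w) + f p
         = s\<^sup>2 * f'' (p + a *\<^sub>R v + b *\<^sub>R w) w"
      using second_difference_eq[OF f' f'' _ s(1), where p = p and w = w] by blast
    have "dist (p + a *\<^sub>R v + b *\<^sub>R w) p < d1"
      using near[of a s b] ab s by simp
    then show ?thesis
      unfolding eq using d1(2) s by simp
  qed
  then show "\<forall>\<^sub>F s in at_right 0. dist ((f (p + s *\<^sub>R v + s *\<^sub>R w) - f (p + s *\<^sub>R v) - f (p + s *\<^sub>R w) + f p) / s\<^sup>2)
      (f'' p w) < e"
    unfolding eventually_at_right_field using r by blast
qed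

text \<open>The second difference quotient is symmetric in \<open>v\<close> and \<open>w\<close>, so
  both mixed derivatives are its limit. The mean value theorem being real-valued, the argument runs
  on the components \<open>f x \<bullet> z\<close>, which determine a vector.\<close>

lemma second_derivative_symmetric:
  fixes f :: "'a::real_normed_vector \<Rightarrow> 'b::real_inner"
  assumes D: "open D" "p \<in> D"
    and f': "\<And>q. q \<in> D \<Longrightarrow> (f has_derivative f' q) (at q)"
    and fv: "\<And>q. q \<in> D \<Longrightarrow> ((\<lambda>x. f' x v) has_derivative fv q) (at q)"
    and fw: "\<And>q. q \<in> D \<Longrightarrow> ((\<lambda>x. f' x w) has_derivative fw q) (at q)"
    and cont: "continuous_on D (\<lambda>q. fv q w)" "continuous_on D (\<lambda>q. fw q v)"
  shows "fv p w = fw p v"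
proof -
  have "fv p w \<bullet> z = fw p v \<bullet> z" for z
  proof -
    let ?\<Delta> = "\<lambda>s. (f (p + s *\<^sub>R v + s *\<^sub>R w) \<bullet> z - f (p + s *\<^sub>R v) \<bullet> z - f (p + s *\<^sub>R w) \<bullet> z + f p \<bullet> z) / s\<^sup>2"
    have 1: "(?\<Delta> \<longlongrightarrow> fv p w \<bullet> z) (at_right 0)"
      by (rule second_difference_tendsto[OF D, where f' = "\<lambda>q x. f' q x \<bullet> z" and f'' = "\<lambda>q x. fv q x \<bullet> z"])
        (auto intro!: has_derivative_inner_left f' fv continuous_intros cont)
    have "((\<lambda>s. (f (p + s *\<^sub>R w + s *\<^sub>R v) \<bullet> z - f (p + s *\<^sub>R w) \<bullet> z - f (p + s *\<^sub>R v) \<bullet> z + f p \<bullet> z) / s\<^sup>2)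
        \<longlongrightarrow> fw p v \<bullet> z) (at_right 0)"
      by (rule second_difference_tendsto[OF D, where f' = "\<lambda>q x. f' q x \<bullet> z" and f'' = "\<lambda>q x. fw q x \<bullet> z"])
        (auto intro!: has_derivative_inner_left f' fw continuous_intros cont)
    then have 2: "(?\<Delta> \<longlongrightarrow> fw p v \<bullet> z) (at_right 0)"
      by (simp add: algebra_simps)
    show ?thesis
      using tendsto_unique[OF _ 1 2] by simp
  qed
  then show ?thesis using vector_eq_rdot by blast
qed

section \<open>The second fundamental form of a regular patch\<close>

text \<open>As \<open>normal_part\<close> is a definite description, its linearity comes from the
  uniqueness of the orthogonal decomposition.\<close>

lemma normal_part_add: "normal_part X p (x + y) = normal_part X p x + normal_part X p y"
proof (rule normal_part_unique)
  show "normal_part X p x + normal_part X p y \<in> normal_space X p"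
    using normal_part_in_normal_space(1)[of X p] unfolding normal_space_def
    by (intro subspace_add subspace_orthogonal_comp) auto
  have "(x - normal_part X p x) + (y - normal_part X p y) \<in> tangent_space X p"
    using normal_part_in_normal_space(2)[of _ X p] unfolding tangent_space_def
    by (intro span_add) auto
  then show "x + y - (normal_part X p x + normal_part X p y) \<in> tangent_space X p"
    by (simp add: algebra_simps)
qed

lemma normal_part_scaleR: "normal_part X p (c *\<^sub>R x) = c *\<^sub>R normal_part X p x"
proof (rule normal_part_unique)
  show "c *\<^sub>R normal_part X p x \<in> normal_space X p"
    using normal_part_in_normal_space(1)[of X p] unfolding normal_space_def
    by (intro subspace_scale subspace_orthogonal_comp) auto
  have "c *\<^sub>R (x - normal_part X p x) \<in> tangent_space X p"
    using normal_part_in_normal_space(2)[of _ X p] unfolding tangent_space_def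
    by (intro span_scale) auto
  then show "c *\<^sub>R x - c *\<^sub>R normal_part X p x \<in> tangent_space X p"
    by (simp add: algebra_simps)
qed

text \<open>The Chen condition is pointwise, so one point is fixed. The domain \<open>D\<close>
  remains as the open neighbourhood on which symmetry of second derivatives is proved.\<close>

locale patch_point =
  fixes D :: "(real \<times> real) set" and X :: "real \<times> real \<Rightarrow> real ^ 4" and p :: "real \<times> real"
  assumes patch: "regular_patch D X" and point: "p \<in> D"
begin

lemma open_domain: "open D"
  using patch unfolding regular_patch_def by blast

lemma inj_derivative: "inj (frechet_derivative X (at p))"
  using patch point unfolding regular_patch_def by blast

lemma
  shows differentiable: "q \<in> D \<Longrightarrow> X differentiable (at q)"
    and differentiable_derivative:
      "q \<in> D \<Longrightarrow> (\<lambda>x. frechet_derivative X (at x) v) differentiable (at q)"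
    and continuous_second_derivative:
      "continuous_on D (\<lambda>q. frechet_derivative (\<lambda>x. frechet_derivative X (at x) v) (at q) w)"
proof -
  have "Ck_on (Suc (Suc 0)) D X"
    using patch unfolding regular_patch_def smooth_on_def by blast
  then show "q \<in> D \<Longrightarrow> X differentiable (at q)"
    "q \<in> D \<Longrightarrow> (\<lambda>x. frechet_derivative X (at x) v) differentiable (at q)"
    "continuous_on D (\<lambda>q. frechet_derivative (\<lambda>x. frechet_derivative X (at x) v) (at q) w)"
    unfolding Ck_on.simps by blast+
qed

lemmas linear_derivative = linear_frechet_derivative[OF differentiable[OF point]]

lemma frame_inner [simp]:
  "frame_X X p \<bullet> frame_X X p = 1" "frame_Y X p \<bullet> frame_Y X p = 1"
  "frame_X X p \<bullet> frame_Y X p = 0" "frame_Y X p \<bullet> frame_X X p = 0"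
  using frame_orthonormal(1-3)[OF inj_derivative differentiable[OF point]]
  by (auto simp: norm_eq_1 inner_commute)

text \<open>Tangent vectors can thus be written as images of coordinate vectors, which
  \<open>sff\<close> recovers through \<open>inv\<close>.\<close>

lemma tangent_space_eq_range: "tangent_space X p = range (frechet_derivative X (at p))"
proof -
  have "z \<in> span {(1, 0), (0, 1)}" for z :: "real \<times> real"
  proof -
    have "fst z *\<^sub>R (1, 0) + snd z *\<^sub>R (0, 1) \<in> span {(1 :: real, 0 :: real), (0, 1)}"
      by (intro span_add span_scale) (auto intro: span_base)
    then show ?thesis by simp
  qed
  then have "span {(1 :: real, 0 :: real), (0, 1)} = UNIV" by blast
  then show ?thesis
    unfolding tangent_space_def X_u_def X_v_def
    using linear_span_image[OF linear_derivative, of "{(1, 0), (0, 1)}"] by simp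
qed

lemma sff_derivative:
  "sff X p (frechet_derivative X (at p) z) (frechet_derivative X (at p) z') = normal_part X p
     (frechet_derivative (\<lambda>q. frechet_derivative X (at q) z') (at p) z)"
  unfolding sff_def Let_def using inj_derivative by simp

lemma sff_symmetric:
  assumes "Z \<in> tangent_space X p" "Z' \<in> tangent_space X p"
  shows "sff X p Z Z' = sff X p Z' Z"
proof -
  obtain z z' where z: "Z = frechet_derivative X (at p) z" "Z' = frechet_derivative X (at p) z'"
    using assms unfolding tangent_space_eq_range by auto
  have "frechet_derivative (\<lambda>q. frechet_derivative X (at q) z') (at p) z
      = frechet_derivative (\<lambda>q. frechet_derivative X (at q) z) (at p) z'"
    by (rule second_derivative_symmetric[OF open_domain point
          frechet_derivative_works[THEN iffD1, OF differentiable]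
          frechet_derivative_works[THEN iffD1, OF differentiable_derivative]
          frechet_derivative_works[THEN iffD1, OF differentiable_derivative]
          continuous_second_derivative continuous_second_derivative])
  then show ?thesis unfolding z sff_derivative by simp
qed

text \<open>The extended field in \<open>sff\<close> depends only on the second argument; the first
  is merely the direction of differentiation, and a derivative is linear in its direction.\<close>

lemma sff_linear_left:
  assumes "Z1 \<in> tangent_space X p" "Z2 \<in> tangent_space X p" "Z' \<in> tangent_space X p"
  shows "sff X p (a *\<^sub>R Z1 + b *\<^sub>R Z2) Z' = a *\<^sub>R sff X p Z1 Z' + b *\<^sub>R sff X p Z2 Z'"
proof -
  let ?d = "frechet_derivative X (at p)"
  obtain z1 z2 z' where z: "Z1 = ?d z1" "Z2 = ?d z2" "Z' = ?d z'"
    using assms unfolding tangent_space_eq_range by auto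
  note lin = linear_frechet_derivative[OF differentiable_derivative[OF point]]
  have "sff X p (?d (a *\<^sub>R z1 + b *\<^sub>R z2)) (?d z') = a *\<^sub>R sff X p Z1 Z' + b *\<^sub>R sff X p Z2 Z'"
    unfolding z sff_derivative
    by (simp add: linear_add[OF lin] linear_scale[OF lin] normal_part_add normal_part_scaleR)
  then show ?thesis
    unfolding z by (simp add: linear_add[OF linear_derivative] linear_scale[OF linear_derivative])
qed

text \<open>Symmetry transfers linearity from the first argument, which avoids differentiating a
  combination of extended fields.\<close>

lemma sff_linear_right:
  assumes "Z1 \<in> tangent_space X p" "Z2 \<in> tangent_space X p" "Z \<in> tangent_space X p"
  shows "sff X p Z (a *\<^sub>R Z1 + b *\<^sub>R Z2) = a *\<^sub>R sff X p Z Z1 + b *\<^sub>R sff X p Z Z2"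
proof -
  have "a *\<^sub>R Z1 + b *\<^sub>R Z2 \<in> tangent_space X p"
    using assms unfolding tangent_space_def by (intro span_add span_scale)
  then show ?thesis
    using sff_linear_left[OF assms] sff_symmetric[OF assms(3)] assms(1,2) by simp
qed

section \<open>Shape operators and their traces in the orthonormal tangent frame\<close>

lemma tangent_vector_expansion:
  assumes "Z \<in> tangent_space X p"
  shows "Z = (Z \<bullet> frame_X X p) *\<^sub>R frame_X X p + (Z \<bullet> frame_Y X p) *\<^sub>R frame_Y X p"
proof -
  obtain a b where "Z = a *\<^sub>R frame_X X p + b *\<^sub>R frame_Y X p"
    using assms
    unfolding tangent_space_eq_span_frame[OF inj_derivative differentiable[OF point]]
    by (auto simp: span_insert span_singleton algebra_simps)
  then show ?thesis by (simp add: inner_add_left)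
qed

text \<open>The defining property, tested on the two frame vectors, fixes both coefficients of the
  image; bilinearity of \<open>sff\<close> extends it to all tangent vectors.\<close>

lemma shape_operator_eq:
  assumes Z: "Z \<in> tangent_space X p"
  shows "shape_operator X p n Z =
    (sff X p Z (frame_X X p) \<bullet> n) *\<^sub>R frame_X X p + (sff X p Z (frame_Y X p) \<bullet> n) *\<^sub>R frame_Y X p"
    (is "_ = ?S")
  unfolding shape_operator_def
proof (rule the_equality, intro conjI ballI)
  show "?S \<in> tangent_space X p"
    using frame_in_tangent_space[of X p] unfolding tangent_space_def
    by (intro span_add span_scale)
  fix Z' assume Z': "Z' \<in> tangent_space X p"
  define a where "a = Z' \<bullet> frame_X X p"
  define b where "b = Z' \<bullet> frame_Y X p"
  have eq: "Z' = a *\<^sub>R frame_X X p + b *\<^sub>R frame_Y X p"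
    unfolding a_def b_def by (rule tangent_vector_expansion[OF Z'])
  show "?S \<bullet> Z' = sff X p Z Z' \<bullet> n"
    unfolding eq sff_linear_right[OF frame_in_tangent_space Z]
    by (simp add: inner_add_left inner_add_right)
next
  fix T assume T: "T \<in> tangent_space X p \<and> (\<forall>Z'\<in>tangent_space X p. T \<bullet> Z' = sff X p Z Z' \<bullet> n)"
  then show "T = ?S"
    using tangent_vector_expansion[of T] frame_in_tangent_space[of X p] by metis
qed

text \<open>The off-diagonal entries of each shape operator agree by symmetry of \<open>sff\<close>,
  hence the factor 2.\<close>

lemma trace_shape_operators:
  "tangent_trace X p (shape_operator X p n1 \<circ> shape_operator X p n2) =
     (sff X p (frame_X X p) (frame_X X p) \<bullet> n1) * (sff X p (frame_X X p) (frame_X X p) \<bullet> n2)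
     + 2 * (sff X p (frame_X X p) (frame_Y X p) \<bullet> n1) * (sff X p (frame_X X p) (frame_Y X p) \<bullet> n2)
     + (sff X p (frame_Y X p) (frame_Y X p) \<bullet> n1) * (sff X p (frame_Y X p) (frame_Y X p) \<bullet> n2)"
proof -
  note T = frame_in_tangent_space[of X p]
  have "a *\<^sub>R frame_X X p + b *\<^sub>R frame_Y X p \<in> tangent_space X p" for a b
    using T unfolding tangent_space_def by (intro span_add span_scale)
  then show ?thesis
    unfolding tangent_trace_def
    by (simp add: T shape_operator_eq sff_linear_left sff_symmetric[OF T(2) T(1)]
        inner_add_left algebra_simps)
qed

section \<open>The Chen condition at a single point\<close>

text \<open>From the Chen condition to the equation, one explicit adapted frame suffices. The
  converse must treat every admissible frame, including arbitrary ones where the mean curvature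
  vector is zero.\<close>

lemma chen_condition_iff:
  assumes N: "orthonormal_normal_pair X p (N1 p) (N2 p)"
  defines "H1 \<equiv> harmonic_curvature X N1 p" and "H2 \<equiv> harmonic_curvature X N2 p"
  shows "(\<forall>n1 n2. orthonormal_normal_pair X p n1 n2 \<and> (\<exists>c. mean_curvature_vector X p = c *\<^sub>R n1)
      \<longrightarrow> allied_mean_curvature X p n1 n2 = 0) \<longleftrightarrow>
    ((h11 X N1 p)\<^sup>2 - (h11 X N2 p)\<^sup>2 + (h22 X N1 p)\<^sup>2 - (h22 X N2 p)\<^sup>2
        + 2 * (h12 X N1 p)\<^sup>2 - 2 * (h12 X N2 p)\<^sup>2) * H1 * H2
      + (h11 X N1 p * h11 X N2 p + h22 X N1 p * h22 X N2 p + 2 * h12 X N1 p * h12 X N2 p)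
        * (H2\<^sup>2 - H1\<^sup>2) = 0"
    (is "?chen \<longleftrightarrow> ?lhs = 0")
proof -
  let ?H = "mean_curvature_vector X p"
  define Q where "Q n m = tangent_trace X p (shape_operator X p n \<circ> shape_operator X p m)" for n m
  have Q_commute: "Q n m = Q m n" for n m
    unfolding Q_def trace_shape_operators by simp
  have Q_linear: "Q n (a *\<^sub>R k + b *\<^sub>R l) = a * Q n k + b * Q n l" for n a b k l
    unfolding Q_def trace_shape_operators by (simp add: inner_add_right algebra_simps)
  have Q_linear': "Q (a *\<^sub>R k + b *\<^sub>R l) n = a * Q k n + b * Q l n" for n a b k l
    using Q_linear Q_commute by metis
  have lhs: "?lhs = (Q (N1 p) (N1 p) - Q (N2 p) (N2 p)) * H1 * H2 + Q (N1 p) (N2 p) * (H2\<^sup>2 - H1\<^sup>2)"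
    unfolding Q_def trace_shape_operators h11_def h12_def h22_def
    by (simp add: power2_eq_square algebra_simps)
  have unit: "N1 p \<bullet> N1 p = 1" "N2 p \<bullet> N2 p = 1" "N1 p \<bullet> N2 p = 0" "N2 p \<bullet> N1 p = 0"
    using N unfolding orthonormal_normal_pair_def by (auto simp: norm_eq_1 inner_commute)
  have H: "?H = H1 *\<^sub>R N1 p + H2 *\<^sub>R N2 p"
    unfolding H1_def H2_def
    by (rule mean_curvature_vector_eq[OF inj_derivative differentiable[OF point]]) (rule N)
  have allied: "allied_mean_curvature X p n1 n2 = (norm ?H / 2 * Q n1 n2) *\<^sub>R n2" for n1 n2
    unfolding allied_mean_curvature_def Q_def ..
  show ?thesis
  proof
    assume chen: ?chen
    show "?lhs = 0"
    proof (cases "?H = 0")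
      case True
      then have "?H \<bullet> N1 p = 0" "?H \<bullet> N2 p = 0" by simp_all
      then have "H1 = 0" "H2 = 0" unfolding H by (simp_all add: inner_add_left unit)
      then show ?thesis by simp
    next
      case False
      define r where "r = norm ?H"
      have r: "r > 0" unfolding r_def using False by simp
      have r2: "r\<^sup>2 = H1\<^sup>2 + H2\<^sup>2"
        unfolding r_def power2_norm_eq_inner H
        by (simp add: inner_add_left inner_add_right unit power2_eq_square)
      \<comment> \<open>The normalised mean curvature vector, followed by its quarter turn in the
        normal plane with basis \<open>N1 p\<close>, \<open>N2 p\<close>.\<close>
      define n1 where "n1 = (H1 / r) *\<^sub>R N1 p + (H2 / r) *\<^sub>R N2 p"
      define n2 where "n2 = (- H2 / r) *\<^sub>R N1 p + (H1 / r) *\<^sub>R N2 p"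
      have sum1: "(H1 / r)\<^sup>2 + (H2 / r)\<^sup>2 = 1"
        using r by (simp add: power_divide r2[symmetric] flip: add_divide_distrib)
      have n22: "n2 \<bullet> n2 = 1"
        unfolding n2_def using sum1
        by (simp add: inner_diff_left inner_diff_right unit power2_eq_square)
      have "n1 \<bullet> n1 = 1"
        unfolding n1_def using sum1
        by (simp add: inner_add_left inner_add_right unit power2_eq_square)
      moreover have "n1 \<bullet> n2 = 0"
        unfolding n1_def n2_def by (simp add: inner_add_left inner_diff_right unit)
      moreover have "n1 \<in> normal_space X p" "n2 \<in> normal_space X p"
        using N unfolding n1_def n2_def orthonormal_normal_pair_def normal_space_def
        by (auto intro!: subspace_add subspace_diff subspace_scale subspace_orthogonal_comp)
      ultimately have "orthonormal_normal_pair X p n1 n2"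
        using n22 unfolding orthonormal_normal_pair_def by (simp add: norm_eq_1)
      moreover have "?H = r *\<^sub>R n1"
        unfolding H n1_def using r by (simp add: scaleR_add_right)
      ultimately have "(norm ?H / 2 * Q n1 n2) *\<^sub>R n2 = 0"
        using chen unfolding allied by blast
      then have "Q n1 n2 = 0"
        using n22 False by auto
      \<comment> \<open>Bilinear expansion of \<open>Q\<close>; the factor \<open>r\<^sup>2\<close>
        clears the denominators of the normalised frame.\<close>
      moreover have "r\<^sup>2 * Q n1 n2 = - ?lhs"
        unfolding lhs n1_def n2_def Q_linear Q_linear' Q_commute[of "N2 p" "N1 p"]
        using r by (simp add: field_simps power2_eq_square)
      ultimately show ?thesis by simp
    qed
  next
    assume eq0: "?lhs = 0"
    show ?chen
    proof (intro allI impI, elim conjE exE)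
      fix n1 n2 c
      assume n: "orthonormal_normal_pair X p n1 n2" and Hc: "?H = c *\<^sub>R n1"
      have norms: "n1 \<bullet> n1 = 1" "n2 \<bullet> n2 = 1" "n1 \<bullet> n2 = 0"
        and normal: "n1 \<in> normal_space X p" "n2 \<in> normal_space X p"
        using n unfolding orthonormal_normal_pair_def by (auto simp: norm_eq_1)
      note expand = normal_vector_expansion[OF inj_derivative differentiable[OF point] N]
      obtain a b where ab: "n1 = a *\<^sub>R N1 p + b *\<^sub>R N2 p"
        using expand[OF normal(1)] by blast
      obtain a' b' where ab': "n2 = a' *\<^sub>R N1 p + b' *\<^sub>R N2 p"
        using expand[OF normal(2)] by blast
      have rel: "a * a + b * b = 1" "a * a' + b * b' = 0"
        using norms(1,3) unfolding ab ab'
        by (simp_all add: inner_add_left inner_add_right unit mult.commute)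
      \<comment> \<open>The determinant of the change of frame. Orthonormality makes
        \<open>n2\<close> equal to \<open>e\<close> times the quarter turn of \<open>n1\<close>, so
        both orientations are covered at once.\<close>
      define e where "e = a * b' - b * a'"
      have a': "a' = - e * b" and b': "b' = e * a"
        unfolding e_def using rel by algebra+
      have "?H \<bullet> N1 p = c * a" "?H \<bullet> N2 p = c * b"
        unfolding Hc ab by (simp_all add: inner_add_left unit)
      then have H12: "H1 = c * a" "H2 = c * b"
        unfolding H by (simp_all add: inner_add_left unit)
      have "c\<^sup>2 * Q n1 n2 = - e * ?lhs"
        unfolding lhs unfolding ab ab' H12 a' b' Q_linear Q_linear' Q_commute[of "N2 p" "N1 p"]
        by (simp add: algebra_simps power2_eq_square)
      \<comment> \<open>If \<open>c\<close> is zero, the mean curvature vector vanishes, and its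
        norm is a factor of the allied vector; otherwise the factor \<open>Q n1 n2\<close>
        vanishes.\<close>
      then have "c = 0 \<or> Q n1 n2 = 0" using eq0 by simp
      then show "allied_mean_curvature X p n1 n2 = 0"
        unfolding allied using Hc by auto
    qed
  qed
qed

end

text \<open>The equation cannot detect triviality: a plane satisfies it with all coefficients zero.
  Hence non-triviality is a premise in the first conjunct, while the second characterises all Chen
  surfaces.\<close>

theorem theorem5p1:
  fixes D :: "(real \<times> real) set" and X N1 N2 :: "real \<times> real \<Rightarrow> real ^ 4"
  assumes "regular_patch D X"
    and "orthonormal_normal_frame D X N1 N2"
  shows "let H1 = harmonic_curvature X N1; H2 = harmonic_curvature X N2;
             equation = (\<forall>p\<in>D.
               ((h11 X N1 p)\<^sup>2 - (h11 X N2 p)\<^sup>2 + (h22 X N1 p)\<^sup>2 - (h22 X N2 p)\<^sup>2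
                  + 2 * (h12 X N1 p)\<^sup>2 - 2 * (h12 X N2 p)\<^sup>2) * H1 p * H2 p
               + (h11 X N1 p * h11 X N2 p + h22 X N1 p * h22 X N2 p + 2 * h12 X N1 p * h12 X N2 p)
                  * ((H2 p)\<^sup>2 - (H1 p)\<^sup>2) = 0)
         in (\<not> trivial_type D X \<longrightarrow> (nontrivial_chen_surface D X \<longleftrightarrow> equation)) \<and>
            (chen_surface D X \<longleftrightarrow> equation)"
proof -
  have "chen_surface D X \<longleftrightarrow> (\<forall>p\<in>D.
      ((h11 X N1 p)\<^sup>2 - (h11 X N2 p)\<^sup>2 + (h22 X N1 p)\<^sup>2 - (h22 X N2 p)\<^sup>2
         + 2 * (h12 X N1 p)\<^sup>2 - 2 * (h12 X N2 p)\<^sup>2)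
         * harmonic_curvature X N1 p * harmonic_curvature X N2 p
      + (h11 X N1 p * h11 X N2 p + h22 X N1 p * h22 X N2 p + 2 * h12 X N1 p * h12 X N2 p)
         * ((harmonic_curvature X N2 p)\<^sup>2 - (harmonic_curvature X N1 p)\<^sup>2) = 0)"
    unfolding chen_surface_def
  proof (rule ball_cong[OF refl])
    fix p assume "p \<in> D"
    then interpret patch_point D X p
      using assms(1) by unfold_locales
    show "(\<forall>n1 n2. orthonormal_normal_pair X p n1 n2 \<and> (\<exists>c. mean_curvature_vector X p = c *\<^sub>R n1)
        \<longrightarrow> allied_mean_curvature X p n1 n2 = 0) \<longleftrightarrow>
      ((h11 X N1 p)\<^sup>2 - (h11 X N2 p)\<^sup>2 + (h22 X N1 p)\<^sup>2 - (h22 X N2 p)\<^sup>2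
         + 2 * (h12 X N1 p)\<^sup>2 - 2 * (h12 X N2 p)\<^sup>2)
         * harmonic_curvature X N1 p * harmonic_curvature X N2 p
      + (h11 X N1 p * h11 X N2 p + h22 X N1 p * h22 X N2 p + 2 * h12 X N1 p * h12 X N2 p)
         * ((harmonic_curvature X N2 p)\<^sup>2 - (harmonic_curvature X N1 p)\<^sup>2) = 0"
      using assms(2) \<open>p \<in> D\<close> unfolding orthonormal_normal_frame_def
      by (intro chen_condition_iff) blast
  qed
  then show ?thesis
    unfolding nontrivial_chen_surface_def Let_def by blast
qed

end
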